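(* Let $m,n\geq 1$ be integers and let $A\in\mathbb{R}^{m\times n}$ be a strictly sign regular (SSR) matrix. Then for each of the four borders of $A$ (left, right, top, bottom) one can add a line at that border (that is, a new first column, a new last column, a new first row, or a new last row, with real entries, the entries of $A$ being left unchanged) such that the resulting $m\times(n+1)$ or $(m+1)\times n$ matrix is SSR. Moreover, if the enlarged matrix has minors of a larger size than those of $A$ (i.e. minors of size $\min\{m,n\}+1$), then for each choice of sign $\eta\in\{1,-1\}$ the new line can be chosen so that the enlarged matrix is SSR and all its minors of size $\min\{m,n\}+1$ have sign $\eta$.
   Context: All matrices are real. An $m\times n$ matrix $A$ is strictly sign regular (SSR) if there are signs $\epsilon_1,\ldots,\epsilon_{\min\{m,n\}}\in\{1,-1\}$ such that for every $1\leq k\leq \min\{m,n\}$, all $k\times k$ minors of $A$ are non-zero and have sign $\epsilon_k$. Here the $k\times k$ minors are the determinants of the submatrices with rows $I$ and columns $J$, $|I|=|J|=k$, rows and columns kept in increasing order. A "line" means a row or a column. *)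

theory Defs
  imports "Jordan_Normal_Form.DL_Submatrix" "Jordan_Normal_Form.Determinant"
begin

text \<open>
  Rows and columns are indexed from 0, and \<open>submatrix\<close> keeps the selected rows and columns in
  increasing order. Since \<open>s\<close> is always taken from \<open>{1, -1}\<close>, the equation \<open>sgn x = s\<close>
  includes \<open>x \<noteq> 0\<close>.
\<close>

definition minors_have_sign :: "real mat \<Rightarrow> nat \<Rightarrow> real \<Rightarrow> bool" where
  "minors_have_sign A k s \<longleftrightarrow>
     (\<forall>I J. I \<subseteq> {..<dim_row A} \<and> J \<subseteq> {..<dim_col A} \<and> card I = k \<and> card J = k \<longrightarrow>
        sgn (det (submatrix A I J)) = s)"

definition strictly_sign_regular :: "real mat \<Rightarrow> bool" where
  "strictly_sign_regular A \<longleftrightarrow>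
     (\<exists>\<epsilon> :: nat \<Rightarrow> real. \<forall>k \<in> {1..min (dim_row A) (dim_col A)}.
        \<epsilon> k \<in> {1, -1} \<and> minors_have_sign A k (\<epsilon> k))"

definition add_col_left :: "'a vec \<Rightarrow> 'a mat \<Rightarrow> 'a mat" where
  "add_col_left v A = mat_of_cols (dim_row A) (v # cols A)"

definition add_col_right :: "'a vec \<Rightarrow> 'a mat \<Rightarrow> 'a mat" where
  "add_col_right v A = mat_of_cols (dim_row A) (cols A @ [v])"

definition add_row_top :: "'a vec \<Rightarrow> 'a mat \<Rightarrow> 'a mat" where
  "add_row_top v A = mat_of_rows (dim_col A) (v # rows A)"

definition add_row_bottom :: "'a vec \<Rightarrow> 'a mat \<Rightarrow> 'a mat" where
  "add_row_bottom v A = mat_of_rows (dim_col A) (rows A @ [v])"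

lemma add_line_carrier:
  assumes "A \<in> carrier_mat m n"
  shows "add_col_left v A \<in> carrier_mat m (n + 1)"
    and "add_col_right v A \<in> carrier_mat m (n + 1)"
    and "add_row_top w A \<in> carrier_mat (m + 1) n"
    and "add_row_bottom w A \<in> carrier_mat (m + 1) n"
  using assms
  by (auto simp: add_col_left_def add_col_right_def add_row_top_def add_row_bottom_def)

lemma add_col_index:
  assumes "A \<in> carrier_mat m n" "i < m"
  shows "add_col_left v A $$ (i, 0) = v $ i"
    and "j < n \<Longrightarrow> add_col_left v A $$ (i, Suc j) = A $$ (i, j)"
    and "j < n \<Longrightarrow> add_col_right v A $$ (i, j) = A $$ (i, j)"
    and "add_col_right v A $$ (i, n) = v $ i"
  using assms
  by (auto simp: add_col_left_def add_col_right_def mat_of_cols_index nth_append)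

lemma add_row_index:
  assumes "A \<in> carrier_mat m n" "j < n"
  shows "add_row_top v A $$ (0, j) = v $ j"
    and "i < m \<Longrightarrow> add_row_top v A $$ (Suc i, j) = A $$ (i, j)"
    and "i < m \<Longrightarrow> add_row_bottom v A $$ (i, j) = A $$ (i, j)"
    and "add_row_bottom v A $$ (m, j) = v $ j"
  using assms
  by (auto simp: add_row_top_def add_row_bottom_def mat_of_rows_index nth_append)

end

theory Submission
  imports Defs
begin

text \<open>
  Let \<open>a\<^sub>0, \<dots>, a\<^bsub>n-1\<^esub>\<close> be the columns of \<open>A\<close>. As a new last column take
  \<open>a\<^bsub>n-1\<^esub> - t a\<^bsub>n-2\<^esub> + t\<^sup>2 a\<^bsub>n-3\<^esub> - \<dots> + t\<^sup>n y\<close> with small \<open>t > 0\<close>. In a minor that uses the new column,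
  every \<open>a\<^sub>j\<close> already selected contributes nothing, so the lowest power of \<open>t\<close> comes from the last
  column that is not selected. Sorting it into place past the \<open>r\<close> selected columns behind it costs
  \<open>(-1)\<^sup>r\<close>, which cancels the sign of its coefficient: the leading coefficient is a minor of \<open>A\<close> of
  the same size. If all columns of \<open>A\<close> are selected, only \<open>y\<close> contributes. Expanding such a minor
  along \<open>y\<close>, with \<open>y\<^sub>i\<close> a fixed sign times \<open>u\<^bsup>m-i\<^esup>\<close> for small \<open>u > 0\<close>, the last selected row dominates, so the sign of
  these minors can be prescribed. The other borders follow by transposition and by reversing the
  order of the rows.
\<close>

section \<open>Minors indexed by increasing sequences\<close>

text \<open>Stands for a set of \<open>k\<close> selected rows or columns, listed in increasing
  order; only the values below \<open>k\<close> count. Inserting, dropping and reflecting indices is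
  easier here than with \<open>pick\<close>.\<close>

definition index_seq :: "nat \<Rightarrow> nat \<Rightarrow> (nat \<Rightarrow> nat) \<Rightarrow> bool" where
  "index_seq k m f \<longleftrightarrow> strict_mono_on {..<k} f \<and> f ` {..<k} \<subseteq> {..<m}"

lemma index_seqI:
  assumes "\<And>i j. i < j \<Longrightarrow> j < k \<Longrightarrow> f i < f j" "\<And>i. i < k \<Longrightarrow> f i < m"
  shows "index_seq k m f"
  using assms by (auto simp: index_seq_def strict_mono_on_def)

lemma index_seq_less: "index_seq k m f \<Longrightarrow> i < k \<Longrightarrow> f i < m"
  by (auto simp: index_seq_def)

lemma index_seq_mono: "index_seq k m f \<Longrightarrow> i < j \<Longrightarrow> j < k \<Longrightarrow> f i < f j"
  by (auto simp: index_seq_def strict_mono_on_def)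

lemma index_seq_inj: "index_seq k m f \<Longrightarrow> inj_on f {..<k}"
  by (auto simp: index_seq_def intro: strict_mono_on_imp_inj_on)

lemma index_seq_ge: "index_seq k m f \<Longrightarrow> i < k \<Longrightarrow> i \<le> f i"
proof (induction i)
  case (Suc i)
  then show ?case using index_seq_mono[of k m f i "Suc i"] by simp
qed simp

lemma index_seq_le: "index_seq k m f \<Longrightarrow> k \<le> m"
  using card_inj_on_le[OF index_seq_inj, of k m f "{..<m}"] by (simp add: index_seq_def)

text \<open>\<open>i \<le> f i\<close> holds by strict monotonicity; the opposite bound follows by
  descending from the last index.\<close>

lemma index_seq_full:
  assumes "index_seq m m f" "i < m"
  shows "f i = i"
proof -
  have "m - 1 - d \<ge> f (m - 1 - d)" if "d < m" for d
    using that
  proof (induction d)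
    case 0
    then show ?case using index_seq_less[OF assms(1), of "m - 1"] by simp
  next
    case (Suc d)
    then have "f (m - 1 - Suc d) < f (m - 1 - d)" by (intro index_seq_mono[OF assms(1)]) auto
    with Suc show ?case by simp
  qed
  from this[of "m - 1 - i"] index_seq_ge[OF assms] assms(2) show ?thesis by simp
qed

lemma index_seq_pick:
  assumes "I \<subseteq> {..<m}" "card I = k"
  shows "index_seq k m (pick I)"
proof (rule index_seqI)
  show "pick I i < pick I j" if "i < j" "j < k" for i j
    using pick_mono_le[of j I i] that assms(2) by simp
  show "pick I i < m" if "i < k" for i
    using pick_in_set_le[of i I] that assms by auto
qed

text \<open>Exactly \<open>i\<close> elements of the image lie below \<open>f i\<close>, and
  \<open>pick\<close> at that count returns the element itself.\<close>

lemma pick_image: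
  assumes "index_seq k m f" "i < k"
  shows "pick (f ` {..<k}) i = f i"
proof -
  have "f j < f i \<longleftrightarrow> j < i" if "j < k" for j
    using that assms(2) index_seq_mono[OF assms(1), of i j] index_seq_mono[OF assms(1), of j i]
    by (cases i j rule: linorder_cases) auto
  then have "{a \<in> f ` {..<k}. a < f i} = f ` {..<i}"
    using assms(2) by auto
  moreover have "inj_on f {..<i}"
    using index_seq_inj[OF assms(1)] assms(2) by (auto intro: inj_on_subset)
  ultimately have "card {a \<in> f ` {..<k}. a < f i} = i" by (simp add: card_image)
  then show ?thesis using pick_card_in_set[of "f i" "f ` {..<k}"] assms(2) by simp
qed

lemma submatrix_pick:
  assumes "A \<in> carrier_mat m n" "I \<subseteq> {..<m}" "J \<subseteq> {..<n}"
  shows "submatrix A I J = mat (card I) (card J) (\<lambda>(i, j). A $$ (pick I i, pick J j))"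
proof -
  have "{i. i < m \<and> i \<in> I} = I" "{j. j < n \<and> j \<in> J} = J" using assms by auto
  then show ?thesis using assms(1) by (simp add: submatrix_def)
qed

text \<open>Sets and sequences correspond via \<open>pick\<close> in one direction and the image in
  the other. Entries of a minor become \<open>A $$ (f i, g j)\<close>.\<close>

lemma minors_have_sign_iff:
  assumes A: "A \<in> carrier_mat m n"
  shows "minors_have_sign A k s \<longleftrightarrow>
    (\<forall>f g. index_seq k m f \<longrightarrow> index_seq k n g \<longrightarrow>
       sgn (det (mat k k (\<lambda>(i, j). A $$ (f i, g j)))) = s)" (is "_ \<longleftrightarrow> ?R")
proof
  assume L: "minors_have_sign A k s"
  show ?R
  proof (intro allI impI)
    fix f g assume f: "index_seq k m f" and g: "index_seq k n g"
    have sub: "f ` {..<k} \<subseteq> {..<m}" "g ` {..<k} \<subseteq> {..<n}"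
      using f g by (auto simp: index_seq_def)
    have card: "card (f ` {..<k}) = k" "card (g ` {..<k}) = k"
      using index_seq_inj[OF f] index_seq_inj[OF g] by (simp_all add: card_image)
    have "submatrix A (f ` {..<k}) (g ` {..<k}) = mat k k (\<lambda>(i, j). A $$ (f i, g j))"
      unfolding submatrix_pick[OF A sub] card
      by (rule cong_mat) (auto simp: pick_image[OF f] pick_image[OF g])
    then show "sgn (det (mat k k (\<lambda>(i, j). A $$ (f i, g j)))) = s"
      using L A sub card unfolding minors_have_sign_def by (metis carrier_matD)
  qed
next
  assume R: ?R
  show "minors_have_sign A k s"
    unfolding minors_have_sign_def
  proof (intro allI impI)
    fix I J
    assume *: "I \<subseteq> {..<dim_row A} \<and> J \<subseteq> {..<dim_col A} \<and> card I = k \<and> card J = k"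
    then have sub: "I \<subseteq> {..<m}" "J \<subseteq> {..<n}" using A by auto
    show "sgn (det (submatrix A I J)) = s"
      using R * index_seq_pick[OF sub(1)] index_seq_pick[OF sub(2)]
      by (simp add: submatrix_pick[OF A sub])
  qed
qed

text \<open>Sizes above both dimensions' minimum have no minors, so any sign does there. Without the
  bound, one sign function can serve \<open>A\<close> and, after one update, the enlarged
  matrix.\<close>

lemma strictly_sign_regular_iff:
  "strictly_sign_regular A \<longleftrightarrow>
    (\<exists>\<epsilon>. (\<forall>k. \<epsilon> k \<in> {1, -1}) \<and> (\<forall>k\<ge>1. minors_have_sign A k (\<epsilon> k)))" (is "_ \<longleftrightarrow> ?R")
proof
  assume "strictly_sign_regular A"
  then obtain \<epsilon> where \<epsilon>: "\<forall>k \<in> {1..min (dim_row A) (dim_col A)}.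
      \<epsilon> k \<in> {1, -1} \<and> minors_have_sign A k (\<epsilon> k)"
    unfolding strictly_sign_regular_def by blast
  define \<epsilon>' where "\<epsilon>' k = (if k \<in> {1..min (dim_row A) (dim_col A)} then \<epsilon> k else 1)" for k
  have "minors_have_sign A k (\<epsilon>' k)" if "k \<ge> 1" for k
  proof (cases "k \<le> min (dim_row A) (dim_col A)")
    case True
    then show ?thesis using \<epsilon> that by (simp add: \<epsilon>'_def)
  next
    case False
    then show ?thesis
      using index_seq_le by (subst minors_have_sign_iff[OF carrier_matI[OF refl refl]]) force
  qed
  moreover have "\<epsilon>' k \<in> {1, -1}" for k using \<epsilon> by (simp add: \<epsilon>'_def)
  ultimately show ?R by blast
next
  assume ?R
  then obtain \<epsilon> where "\<And>k. \<epsilon> k \<in> {1, -1}" "\<And>k. k \<ge> 1 \<Longrightarrow> minors_have_sign A k (\<epsilon> k)"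
    by blast
  then show "strictly_sign_regular A"
    unfolding strictly_sign_regular_def by (intro exI[of _ \<epsilon>]) simp
qed

section \<open>Determinants with an inserted column\<close>

text \<open>The position \<open>q\<close> is a parameter because a minor is needed both with the new
  column last and with it sorted into place.\<close>

definition insert_col :: "nat \<Rightarrow> (nat \<Rightarrow> nat \<Rightarrow> 'a) \<Rightarrow> nat \<Rightarrow> (nat \<Rightarrow> 'a) \<Rightarrow> 'a mat" where
  "insert_col k M q y = mat k k (\<lambda>(i, j). if j < q then M i j else if j = q then y i else M i (j - 1))"

text \<open>Laplace expansion along the inserted column. Deleting that column leaves the same matrix
  for every \<open>q\<close>, so \<open>q\<close> survives only in the sign.\<close>

lemma det_insert_col:
  fixes y :: "nat \<Rightarrow> 'a :: comm_ring_1"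
  assumes "q < k"
  shows "det (insert_col k M q y) =
    (\<Sum>i<k. y i * ((-1) ^ (i + q) *
      det (mat (k - 1) (k - 1) (\<lambda>(i', j'). M (if i' < i then i' else Suc i') j'))))"
proof -
  have "mat_delete (insert_col k M q y) i q =
      mat (k - 1) (k - 1) (\<lambda>(i', j'). M (if i' < i then i' else Suc i') j')" if "i < k" for i
    using that assms by (auto simp: mat_delete_def insert_col_def intro!: eq_matI)
  moreover have "insert_col k M q y \<in> carrier_mat k k" by (simp add: insert_col_def)
  ultimately show ?thesis
    using assms by (subst laplace_expansion_column[of _ k q])
      (auto simp: cofactor_def insert_col_def intro!: sum.cong)
qed

lemma det_insert_col_move:
  fixes y :: "nat \<Rightarrow> 'a :: comm_ring_1"
  assumes "q + r < k"
  shows "det (insert_col k M (q + r) y) = (-1) ^ r * det (insert_col k M q y)"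
  using assms
  by (auto simp: det_insert_col sum_distrib_left power_add algebra_simps intro!: sum.cong)

lemma det_insert_col_sum:
  fixes z :: "'b \<Rightarrow> nat \<Rightarrow> 'a :: comm_ring_1"
  assumes "q < k"
  shows "det (insert_col k M q (\<lambda>i. \<Sum>r\<in>R. z r i * w r)) = (\<Sum>r\<in>R. det (insert_col k M q (z r)) * w r)"
  unfolding det_insert_col[OF assms] sum_distrib_right
  by (subst sum.swap) (simp add: algebra_simps)

lemma det_insert_col_scale:
  fixes y :: "nat \<Rightarrow> 'a :: comm_ring_1"
  assumes "q < k"
  shows "det (insert_col k M q (\<lambda>i. a * y i)) = a * det (insert_col k M q y)"
  by (simp add: det_insert_col[OF assms] sum_distrib_left mult.assoc)

lemma det_insert_col_last_dup:
  fixes M :: "nat \<Rightarrow> nat \<Rightarrow> 'a :: comm_ring_1"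
  assumes "j < k - 1"
  shows "det (insert_col k M (k - 1) (\<lambda>i. M i j)) = 0"
proof (rule det_identical_columns[of _ k j "k - 1"])
  show "col (insert_col k M (k - 1) (\<lambda>i. M i j)) j = col (insert_col k M (k - 1) (\<lambda>i. M i j)) (k - 1)"
    using assms by (auto simp: insert_col_def)
qed (use assms in \<open>auto simp: insert_col_def\<close>)

section \<open>Signs for small positive parameters\<close>

text \<open>Dividing by the positive factor \<open>t ^ e a\<close> leaves \<open>c a\<close> plus
  terms that tend to 0.\<close>

lemma eventually_sgn_sum_powers:
  fixes c :: "'a \<Rightarrow> real" and e :: "'a \<Rightarrow> nat"
  assumes "finite S" "a \<in> S" "c a \<noteq> 0"
    and lead: "\<And>b. b \<in> S \<Longrightarrow> b \<noteq> a \<Longrightarrow> c b \<noteq> 0 \<Longrightarrow> e a < e b"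
  shows "\<forall>\<^sub>F t in at_right 0. sgn (\<Sum>b\<in>S. c b * t ^ e b) = sgn (c a)"
proof -
  define h where "h t = c a + (\<Sum>b\<in>S - {a}. c b * t ^ (e b - e a))" for t
  have "(h \<longlongrightarrow> c a + (\<Sum>b\<in>S - {a}. 0)) (at_right 0)"
    unfolding h_def
  proof (intro tendsto_add tendsto_const tendsto_sum)
    fix b assume b: "b \<in> S - {a}"
    show "((\<lambda>t. c b * t ^ (e b - e a)) \<longlongrightarrow> 0) (at_right 0)"
    proof (cases "c b = 0")
      case False
      with lead[of b] b have "0 < e b - e a" by auto
      then have "((\<lambda>t. c b * t ^ (e b - e a)) \<longlongrightarrow> c b * 0 ^ (e b - e a)) (at_right 0)"
        by (intro tendsto_intros)
      then show ?thesis using \<open>0 < e b - e a\<close> by (simp add: zero_power)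
    qed simp
  qed
  then have "(h \<longlongrightarrow> c a) (at_right 0)" by simp
  then have "\<forall>\<^sub>F t in at_right 0. sgn (h t) = sgn (c a)"
  proof (cases "c a > 0")
    case True
    with order_tendstoD(1)[OF \<open>(h \<longlongrightarrow> c a) (at_right 0)\<close>, of 0] show ?thesis
      by (auto elim: eventually_mono)
  next
    case False
    with \<open>c a \<noteq> 0\<close> order_tendstoD(2)[OF \<open>(h \<longlongrightarrow> c a) (at_right 0)\<close>, of 0] show ?thesis
      by (auto elim: eventually_mono)
  qed
  moreover have "\<forall>\<^sub>F t :: real in at_right 0. t > 0" by (rule eventually_at_right_less)
  ultimately show ?thesis
  proof eventually_elim
    case (elim t)
    have "(\<Sum>b\<in>S. c b * t ^ e b) = c a * t ^ e a + (\<Sum>b\<in>S - {a}. c b * t ^ e b)"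
      using assms by (simp add: sum.remove)
    \<comment> \<open>The subtraction \<open>e b - e a\<close> may truncate only where
      \<open>c b = 0\<close>, and then both sides vanish.\<close>
    also have "(\<Sum>b\<in>S - {a}. c b * t ^ e b) = (\<Sum>b\<in>S - {a}. c b * t ^ (e b - e a) * t ^ e a)"
    proof (rule sum.cong)
      fix b assume "b \<in> S - {a}"
      then show "c b * t ^ e b = c b * t ^ (e b - e a) * t ^ e a"
        using lead[of b] by (cases "c b = 0") (auto simp flip: power_add)
    qed simp
    finally have "(\<Sum>b\<in>S. c b * t ^ e b) = h t * t ^ e a"
      by (simp add: h_def algebra_simps sum_distrib_left)
    with elim show ?case by (simp add: sgn_mult)
  qed
qed

lemma ex_finite_eventually_at_right_0:
  assumes "finite S" "\<And>a. a \<in> S \<Longrightarrow> \<forall>\<^sub>F t :: real in at_right 0. P a t"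
  shows "\<exists>t. \<forall>a\<in>S. P a t"
proof -
  have "\<forall>\<^sub>F t :: real in at_right 0. \<forall>a\<in>S. P a t"
    using assms by (intro eventually_ball_finite) auto
  then show ?thesis by (rule eventually_happens'[rotated]) simp
qed

text \<open>There are only finitely many pairs of index sets, even for infinite \<open>K\<close>, so
  a single \<open>t\<close> suits all minors. The proof returns to sets because the functions
  \<open>f\<close> and \<open>g\<close> are not finitely many.\<close>

lemma minors_have_sign_ex_at_right_0:
  assumes C: "\<And>t. C t \<in> carrier_mat m n"
    and ev: "\<And>k f g. k \<in> K \<Longrightarrow> index_seq k m f \<Longrightarrow> index_seq k n g \<Longrightarrow>
      \<forall>\<^sub>F t in at_right (0 :: real). sgn (det (mat k k (\<lambda>(i, j). C t $$ (f i, g j)))) = s k"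
  shows "\<exists>t. \<forall>k\<in>K. minors_have_sign (C t) k (s k)"
proof -
  define S where
    "S = {(I, J). I \<subseteq> {..<m} \<and> J \<subseteq> {..<n} \<and> card I = card J \<and> card I \<in> K}"
  have "\<exists>t. \<forall>a\<in>S. sgn (det (submatrix (C t) (fst a) (snd a))) = s (card (fst a))"
  proof (rule ex_finite_eventually_at_right_0)
    show "finite S"
      by (rule finite_subset[of _ "Pow {..<m} \<times> Pow {..<n}"]) (auto simp: S_def)
  next
    fix a assume "a \<in> S"
    then have sub: "fst a \<subseteq> {..<m}" "snd a \<subseteq> {..<n}" and k: "card (snd a) = card (fst a)"
      "card (fst a) \<in> K"
      by (auto simp: S_def)
    show "\<forall>\<^sub>F t in at_right 0. sgn (det (submatrix (C t) (fst a) (snd a))) = s (card (fst a))"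
      using ev[OF k(2) index_seq_pick[OF sub(1) refl] index_seq_pick[OF sub(2) k(1)]]
      by (simp add: submatrix_pick[OF C sub] k)
  qed
  then obtain t where t: "\<And>a. a \<in> S \<Longrightarrow>
      sgn (det (submatrix (C t) (fst a) (snd a))) = s (card (fst a))"
    by blast
  have "minors_have_sign (C t) k (s k)" if "k \<in> K" for k
    unfolding minors_have_sign_def
  proof (intro allI impI)
    fix I J
    assume "I \<subseteq> {..<dim_row (C t)} \<and> J \<subseteq> {..<dim_col (C t)} \<and> card I = k \<and> card J = k"
    then show "sgn (det (submatrix (C t) I J)) = s k"
      using t[of "(I, J)"] C[of t] that by (auto simp: S_def)
  qed
  then show ?thesis by blast
qed

section \<open>Adding a last column\<close>

lemma add_col_right_minor:
  assumes A: "A \<in> carrier_mat m n" and f: "index_seq k m f" and g: "index_seq k (Suc n) g"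
    and k: "k \<ge> 1" "g (k - 1) = n"
  shows "mat k k (\<lambda>(i, j). add_col_right (vec m x) A $$ (f i, g j)) =
    insert_col k (\<lambda>i j. A $$ (f i, g j)) (k - 1) (\<lambda>i. x (f i))"
  unfolding insert_col_def
proof (rule cong_mat, goal_cases)
  case (3 i j)
  note fi = index_seq_less[OF f 3(1)]
  show ?case
  proof (cases "j < k - 1")
    case True
    then have "g j < n" using index_seq_mono[OF g True] k by simp
    then show ?thesis using True add_col_index(3)[OF A fi] by simp
  next
    case False
    then have "j = k - 1" using 3 by simp
    then show ?thesis using k fi add_col_index(4)[OF A fi] by simp
  qed
qed simp_all

text \<open>These minors use every column. Expanding along the new one, the term of the last
  selected row dominates, and its cofactor is an \<open>n\<close>-minor of \<open>A\<close>.\<close>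

lemma ex_col_maximal_minors_sign:
  assumes A: "A \<in> carrier_mat m n" and s: "s \<in> {1, -1}" "minors_have_sign A n s"
    and \<eta>: "\<eta> \<in> {1, -1}"
  shows "\<exists>x. minors_have_sign (add_col_right (vec m x) A) (Suc n) \<eta>"
proof -
  \<comment> \<open>The exponent decreases with \<open>i\<close>, so the last selected row carries
    the lowest power; the factor \<open>s\<close> cancels the sign of the
    \<open>n\<close>-minors.\<close>
  define x where "x t i = \<eta> * s * t ^ (m - i)" for t :: real and i
  have "\<exists>t. \<forall>k\<in>{Suc n}. minors_have_sign (add_col_right (vec m (x t)) A) k ((\<lambda>_. \<eta>) k)"
  proof (rule minors_have_sign_ex_at_right_0)
    show "add_col_right (vec m (x t)) A \<in> carrier_mat m (Suc n)" for t
      using add_line_carrier(2)[OF A] by simp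
    fix k f g assume "k \<in> {Suc n}" and f: "index_seq k m f" and g: "index_seq k (Suc n) g"
    then have k: "k = Suc n" by simp
    have gi: "g j = j" if "j < Suc n" for j using index_seq_full g k that by blast
    define c where "c i = \<eta> * s * ((-1) ^ (i + n) *
        det (mat n n (\<lambda>(i', j'). A $$ (f (if i' < i then i' else Suc i'), g j'))))" for i
    have "index_seq n m f" "index_seq n n g"
      using index_seq_mono[OF f] index_seq_less[OF f] gi k by (auto intro!: index_seqI)
    then have "sgn (det (mat n n (\<lambda>(i, j). A $$ (f i, g j)))) = s"
      using s(2) unfolding minors_have_sign_iff[OF A] by blast
    also have "mat n n (\<lambda>(i, j). A $$ (f i, g j)) =
        mat n n (\<lambda>(i', j'). A $$ (f (if i' < n then i' else Suc i'), g j'))"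
      by (rule cong_mat) auto
    finally have cn: "sgn (c n) = \<eta>"
      using s \<eta> by (auto simp: c_def sgn_mult)
    have "\<forall>\<^sub>F t in at_right 0. sgn (\<Sum>i<k. c i * t ^ (m - f i)) = sgn (c n)"
    proof (rule eventually_sgn_sum_powers)
      show "c n \<noteq> 0" using cn \<eta> by auto
      fix i assume "i \<in> {..<k}" "i \<noteq> n"
      then have "f i < f n" "f n < m"
        using index_seq_mono[OF f, of i n] index_seq_less[OF f, of n] k by auto
      then show "m - f n < m - f i" by simp
    qed (use k in auto)
    moreover have "det (mat k k (\<lambda>(i, j). add_col_right (vec m (x t)) A $$ (f i, g j))) =
        (\<Sum>i<k. c i * t ^ (m - f i))" for t
      using gi k by (subst add_col_right_minor[OF A f g])
        (auto simp: det_insert_col x_def c_def intro!: sum.cong)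
    ultimately show "\<forall>\<^sub>F t in at_right 0.
        sgn (det (mat k k (\<lambda>(i, j). add_col_right (vec m (x t)) A $$ (f i, g j)))) = \<eta>"
      by (simp add: cn)
  qed
  then show ?thesis by auto
qed

text \<open>
  If \<open>n\<close> is the last of the selected indices, \<open>n - 1 - r\<close> is the largest index below it that is not
  selected.
\<close>
lemma index_seq_trailing_run:
  assumes g: "index_seq k (Suc n) g" and k: "1 \<le> k" "k \<le> n" and last: "g (k - 1) = n"
  obtains r where "r < k" "\<And>s. s \<le> r \<Longrightarrow> g (k - 1 - s) = n - s"
    "\<And>j. j < k - 1 - r \<Longrightarrow> g j < n - 1 - r"
proof -
  \<comment> \<open>\<open>P\<close> follows the run \<open>n, n - 1, ...\<close> of selected
    indices from the end; the conjunct \<open>s < k\<close> guarantees that it breaks off.\<close>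
  define P where "P s \<longleftrightarrow> s < k \<and> g (k - 1 - s) = n - s" for s
  define s where "s = (LEAST s. \<not> P s)"
  have "\<not> P k" by (simp add: P_def)
  then have s: "\<not> P s" unfolding s_def by (rule LeastI)
  have below: "P s'" if "s' < s" for s' using not_less_Least that unfolding s_def by blast
  have "s \<noteq> 0" using s k last by (auto simp: P_def intro!: gr0I)
  then obtain r where r: "s = Suc r" using not0_implies_Suc by blast
  have Pr: "r < k" "g (k - 1 - r) = n - r" using below[of r] r by (auto simp: P_def)
  moreover have "g (k - 1 - s') = n - s'" if "s' \<le> r" for s' using below[of s'] that r by (simp add: P_def)
  moreover have "g j < n - 1 - r" if j: "j < k - 1 - r" for j
  proof -
    have "g (k - 1 - s) < g (k - 1 - r)" using r j by (intro index_seq_mono[OF g]) auto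
    \<comment> \<open>Here \<open>s < k\<close>, so \<open>P s\<close> can fail only because the run
      has a gap at \<open>n - s\<close>.\<close>
    moreover have "g (k - 1 - s) \<noteq> n - s" using s r j by (auto simp: P_def)
    ultimately have "g (k - 1 - s) < n - 1 - r" using Pr r by simp
    moreover have "g j \<le> g (k - 1 - s)"
    proof -
      have "j < k - 1 - s \<or> j = k - 1 - s" using j r by linarith
      then show ?thesis using index_seq_mono[OF g, of j "k - 1 - s"] k by force
    qed
    ultimately show ?thesis by simp
  qed
  ultimately show ?thesis using that by blast
qed

text \<open>\<open>A\<close> has no minors of size \<open>Suc n\<close>, so the sign of that size is
  free to be replaced by \<open>\<eta>\<close>; all smaller sizes keep their sign.\<close>

lemma ex_col_right:
  assumes A: "A \<in> carrier_mat m n" and n: "n \<ge> 1" and \<epsilon>: "\<And>k. \<epsilon> k \<in> {1, -1}"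
    and minors: "\<And>k. k \<ge> 1 \<Longrightarrow> minors_have_sign A k (\<epsilon> k)"
    and \<eta>: "\<eta> \<in> {1, -1}"
  shows "\<exists>x. \<forall>k\<in>{1..}. minors_have_sign (add_col_right (vec m x) A) k ((\<epsilon>(Suc n := \<eta>)) k)"
proof -
  obtain y where y: "minors_have_sign (add_col_right (vec m y) A) (Suc n) \<eta>"
    using ex_col_maximal_minors_sign[OF A \<epsilon> minors[OF n] \<eta>] by blast
  \<comment> \<open>The coefficient of \<open>t ^ r\<close> in the new column: the columns of
    \<open>A\<close> from right to left with alternating signs, then \<open>y\<close>.\<close>
  define z where "z r i = (if r < n then (-1) ^ r * A $$ (i, n - 1 - r) else y i)" for r i
  define x where "x t i = (\<Sum>r\<le>n. z r i * t ^ r)" for t i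
  have "\<exists>t. \<forall>k\<in>{1..}. minors_have_sign (add_col_right (vec m (x t)) A) k ((\<epsilon>(Suc n := \<eta>)) k)"
  proof (rule minors_have_sign_ex_at_right_0)
    show "add_col_right (vec m (x t)) A \<in> carrier_mat m (Suc n)" for t
      using add_line_carrier(2)[OF A] by simp
    fix k :: nat and f g
    assume k: "k \<in> {1..}" and f: "index_seq k m f" and g: "index_seq k (Suc n) g"
    then have k1: "k \<ge> 1" "k - 1 < k" by auto
    have kn: "k \<le> Suc n" using index_seq_le[OF g] .
    let ?minor = "\<lambda>t. det (mat k k (\<lambda>(i, j). add_col_right (vec m (x t)) A $$ (f i, g j)))"
    show "\<forall>\<^sub>F t in at_right 0. sgn (?minor t) = (\<epsilon>(Suc n := \<eta>)) k"
    proof (cases "g (k - 1) = n")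
      \<comment> \<open>The new column is not selected: the minor is one of \<open>A\<close>, and
        \<open>k \<le> n\<close>, so its sign is not the updated one.\<close>
      case False
      have "g j < n" if "j < k" for j
      proof -
        have "j < k - 1 \<or> j = k - 1" using that by linarith
        then show ?thesis
          using False index_seq_mono[OF g, of j "k - 1"] index_seq_less[OF g, of "k - 1"] k1 by force
      qed
      then have g': "index_seq k n g" using index_seq_mono[OF g] by (auto intro!: index_seqI)
      have "mat k k (\<lambda>(i, j). add_col_right (vec m (x t)) A $$ (f i, g j)) =
          mat k k (\<lambda>(i, j). A $$ (f i, g j))" for t
        using add_col_index(3)[OF A] index_seq_less[OF f] index_seq_less[OF g']
        by (intro cong_mat) auto
      then show ?thesis
        using minors[OF k1(1)] f g' index_seq_le[OF g'] by (simp add: minors_have_sign_iff[OF A])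
    next
      case True
      define D where "D u = det (insert_col k (\<lambda>i j. A $$ (f i, g j)) (k - 1) (\<lambda>i. u (f i)))" for u
      define c where "c r = D (z r)" for r
      have minor: "det (mat k k (\<lambda>(i, j). add_col_right (vec m u) A $$ (f i, g j))) = D u" for u
        unfolding D_def by (subst add_col_right_minor[OF A f g k1(1) True]) simp
      have D_z: "c r = (-1) ^ r * D (\<lambda>i. A $$ (i, n - 1 - r))" if "r < n" for r
        using that k1 by (simp add: c_def z_def D_def det_insert_col_scale)
      have D_dup: "D (\<lambda>i. A $$ (i, g j)) = 0" if "j < k - 1" for j
        unfolding D_def using that by (rule det_insert_col_last_dup)
      have expand: "?minor t = (\<Sum>r\<le>n. c r * t ^ r)" for t
        unfolding minor unfolding c_def D_def x_def using k1 by (subst det_insert_col_sum) simp_all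
      \<comment> \<open>It suffices that the first non-zero coefficient has the required
        sign.\<close>
      have "\<exists>r\<le>n. sgn (c r) = (\<epsilon>(Suc n := \<eta>)) k \<and> (\<forall>s<r. c s = 0)"
      proof (cases "k = Suc n")
        case k_full: True
        have car: "add_col_right (vec m y) A \<in> carrier_mat m (Suc n)"
          using add_line_carrier(2)[OF A] by simp
        have "sgn (D y) = \<eta>"
          using y f g unfolding minor[symmetric] k_full minors_have_sign_iff[OF car] by blast
        moreover have "z n = y" by (simp add: z_def fun_eq_iff)
        ultimately have "sgn (c n) = (\<epsilon>(Suc n := \<eta>)) k" by (simp add: c_def k_full)
        \<comment> \<open>Every column of \<open>A\<close> is selected already, so each of these
          terms repeats a column; only \<open>y\<close> remains.\<close>
        moreover have "c s = 0" if "s < n" for s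
          using D_z[OF that] D_dup[of "n - 1 - s"] index_seq_full[of "Suc n" g "n - 1 - s"] g that
          by (simp add: k_full)
        ultimately show ?thesis by blast
      next
        case False
        then have k_le: "k \<le> n" using kn by simp
        obtain r where r: "r < k" and run: "\<And>s. s \<le> r \<Longrightarrow> g (k - 1 - s) = n - s"
          and low: "\<And>j. j < k - 1 - r \<Longrightarrow> g j < n - 1 - r"
          using index_seq_trailing_run[OF g k1(1) k_le True] by blast
        \<comment> \<open>\<open>p\<close> is the last column of \<open>A\<close> that is not
          selected and \<open>q\<close> its place among the selected ones. \<open>h\<close> drops
          the final index \<open>n\<close> of \<open>g\<close> and inserts \<open>p\<close>
          there.\<close>
        define q where "q = k - 1 - r"
        define p where "p = n - 1 - r"
        define h where "h j = (if j < q then g j else if j = q then p else g (j - 1))" for j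
        have low': "g j < p" if "j < q" for j
          using low that by (simp add: q_def p_def)
        have high: "g j > p" if "q \<le> j" "j < k" for j
          using run[of "k - 1 - j"] that r k_le by (simp add: q_def p_def)
        have h: "index_seq k n h"
        proof (rule index_seqI)
          fix i j assume "i < j" "j < k"
          then show "h i < h j"
            using low'[of i] high[of "j - 1"] index_seq_mono[OF g, of i j]
              index_seq_mono[OF g, of i "j - 1"] index_seq_mono[OF g, of "i - 1" "j - 1"]
            by (auto simp: h_def q_def[symmetric] p_def[symmetric])
        next
          fix j assume "j < k"
          then show "h j < n"
            using index_seq_mono[OF g, of j "k - 1"] index_seq_mono[OF g, of "j - 1" "k - 1"]
              True k_le r k1
            by (auto simp: h_def p_def q_def)
        qed
        have "D (\<lambda>i. A $$ (i, p)) = (-1) ^ r *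
            det (insert_col k (\<lambda>i j. A $$ (f i, g j)) q (\<lambda>i. A $$ (f i, p)))"
          using r det_insert_col_move[of q r k] by (simp add: D_def q_def)
        also have "insert_col k (\<lambda>i j. A $$ (f i, g j)) q (\<lambda>i. A $$ (f i, p)) =
            mat k k (\<lambda>(i, j). A $$ (f i, h j))"
          unfolding insert_col_def by (rule cong_mat) (auto simp: h_def)
        \<comment> \<open>The sign of moving past \<open>r\<close> columns cancels the factor
          \<open>(-1) ^ r\<close> in \<open>z r\<close>.\<close>
        finally have "c r = det (mat k k (\<lambda>(i, j). A $$ (f i, h j)))"
          using D_z[of r] r k_le by (simp add: p_def flip: power_add mult.assoc)
        then have "sgn (c r) = \<epsilon> k"
          using minors[OF k1(1)] f h by (simp add: minors_have_sign_iff[OF A])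
        \<comment> \<open>Column \<open>n - 1 - s\<close> belongs to the run and is selected at
          position \<open>k - 1 - Suc s\<close>.\<close>
        moreover have "c s = 0" if "s < r" for s
          using D_z[of s] D_dup[of "k - 1 - Suc s"] run[of "Suc s"] that r k_le by simp
        ultimately show ?thesis using False r k_le by (intro exI[of _ r]) auto
      qed
      then obtain r where r: "r \<le> n" "sgn (c r) = (\<epsilon>(Suc n := \<eta>)) k" "\<And>s. s < r \<Longrightarrow> c s = 0"
        by blast
      then have "c r \<noteq> 0" using \<epsilon>[of k] \<eta> by (auto split: if_splits)
      then have "\<forall>\<^sub>F t in at_right 0. sgn (\<Sum>s\<le>n. c s * t ^ s) = sgn (c r)"
        using r by (intro eventually_sgn_sum_powers) (auto intro: linorder_neqE_nat)
      then show ?thesis by (simp only: expand r(2))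
    qed
  qed
  then show ?thesis by blast
qed

text \<open>
  No relation between \<open>l\<close> and the size of the matrix is required: if it has no minors of size
  \<open>l + 1\<close>, the last conjunct is vacuous.
\<close>
definition extends_SSR :: "(real vec \<Rightarrow> real mat \<Rightarrow> real mat) \<Rightarrow> nat \<Rightarrow> nat \<Rightarrow> real mat \<Rightarrow> bool" where
  "extends_SSR border d l A \<longleftrightarrow> (\<forall>\<eta> \<in> {1, -1}. \<exists>v \<in> carrier_vec d.
     strictly_sign_regular (border v A) \<and> minors_have_sign (border v A) (Suc l) \<eta>)"

lemma extends_SSR_col_right:
  assumes A: "A \<in> carrier_mat m n" and n: "n \<ge> 1" and ssr: "strictly_sign_regular A"
  shows "extends_SSR add_col_right m n A"
  unfolding extends_SSR_def
proof
  fix \<eta> :: real assume \<eta>: "\<eta> \<in> {1, -1}"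
  from ssr obtain \<epsilon> where \<epsilon>: "\<And>k. \<epsilon> k \<in> {1, -1}" "\<And>k. k \<ge> 1 \<Longrightarrow> minors_have_sign A k (\<epsilon> k)"
    unfolding strictly_sign_regular_iff by blast
  let ?\<epsilon> = "\<epsilon>(Suc n := \<eta>)"
  obtain x where x: "\<And>k. k \<ge> 1 \<Longrightarrow> minors_have_sign (add_col_right (vec m x) A) k (?\<epsilon> k)"
    using ex_col_right[OF A n \<epsilon> \<eta>] by auto
  have "strictly_sign_regular (add_col_right (vec m x) A)"
    unfolding strictly_sign_regular_iff using x \<epsilon>(1) \<eta> by (intro exI[of _ ?\<epsilon>]) auto
  moreover have "minors_have_sign (add_col_right (vec m x) A) (Suc n) \<eta>"
    using x[of "Suc n"] by simp
  ultimately show "\<exists>v \<in> carrier_vec m. strictly_sign_regular (add_col_right v A) \<and>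
      minors_have_sign (add_col_right v A) (Suc n) \<eta>"
    by (intro bexI[of _ "vec m x"]) auto
qed

section \<open>Transposition\<close>

lemma minors_have_sign_transpose: "minors_have_sign A\<^sup>T k s \<longleftrightarrow> minors_have_sign A k s"
proof -
  define m n where "m = dim_row A" and "n = dim_col A"
  then have A: "A \<in> carrier_mat m n" by auto
  have det: "det (mat k k (\<lambda>(i, j). A\<^sup>T $$ (g i, f j))) = det (mat k k (\<lambda>(i, j). A $$ (f i, g j)))"
    if "index_seq k m f" "index_seq k n g" for f g
  proof -
    have "mat k k (\<lambda>(i, j). A\<^sup>T $$ (g i, f j)) = (mat k k (\<lambda>(i, j). A $$ (f i, g j)))\<^sup>T"
      using A index_seq_less[OF that(1)] index_seq_less[OF that(2)] by (intro eq_matI) auto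
    then show ?thesis by (simp add: det_transpose[of _ k])
  qed
  show ?thesis
    unfolding minors_have_sign_iff[OF A] minors_have_sign_iff[OF transpose_carrier_mat[THEN iffD2, OF A]]
    using det by auto
qed

lemma strictly_sign_regular_transpose: "strictly_sign_regular A\<^sup>T \<longleftrightarrow> strictly_sign_regular A"
  by (simp add: strictly_sign_regular_iff minors_have_sign_transpose)

text \<open>Serves twice: for the bottom row from the right column, and for the left column from the
  top row.\<close>

lemma extends_SSR_transpose:
  assumes "\<And>v. v \<in> carrier_vec d \<Longrightarrow> (border v A\<^sup>T)\<^sup>T = border' v A" "extends_SSR border d l A\<^sup>T"
  shows "extends_SSR border' d l A"
  unfolding extends_SSR_def
proof
  fix \<eta> :: real assume "\<eta> \<in> {1, -1}"
  then obtain v where v: "v \<in> carrier_vec d" "strictly_sign_regular (border v A\<^sup>T)"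
    "minors_have_sign (border v A\<^sup>T) (Suc l) \<eta>"
    using assms(2) unfolding extends_SSR_def by blast
  then have "strictly_sign_regular (border' v A)" "minors_have_sign (border' v A) (Suc l) \<eta>"
    unfolding assms(1)[OF v(1), symmetric]
    by (simp_all only: strictly_sign_regular_transpose minors_have_sign_transpose)
  then show "\<exists>v\<in>carrier_vec d. strictly_sign_regular (border' v A) \<and>
      minors_have_sign (border' v A) (Suc l) \<eta>"
    using v(1) by blast
qed

lemma transpose_add_col_right: "(add_col_right v A\<^sup>T)\<^sup>T = add_row_bottom v A"
  by (simp add: add_col_right_def add_row_bottom_def transpose_mat_of_cols)

lemma transpose_add_row_top: "(add_row_top v A\<^sup>T)\<^sup>T = add_col_left v A"
  by (simp add: add_row_top_def add_col_left_def transpose_mat_of_rows)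

section \<open>Reversing the order of the rows\<close>

definition flip_rows :: "'a mat \<Rightarrow> 'a mat" where
  "flip_rows A = mat (dim_row A) (dim_col A) (\<lambda>(i, j). A $$ (dim_row A - 1 - i, j))"

lemma flip_rows_carrier: "A \<in> carrier_mat m n \<Longrightarrow> flip_rows A \<in> carrier_mat m n"
  by (auto simp: flip_rows_def)

text \<open>Reversal is one fixed permutation of the \<open>k\<close> rows, so \<open>c\<close> is
  its sign and the same for all matrices of this size.\<close>

lemma det_flip_rows:
  "\<exists>c \<in> {1, -1}. \<forall>M \<in> carrier_mat k k. det (flip_rows M) = c * (det M :: 'a :: comm_ring_1)"
proof -
  \<comment> \<open>\<open>permutes\<close> demands the identity outside the index range;
    \<open>p\<close> is its own inverse.\<close>
  define p where "p i = (if i < k then k - 1 - i else i)" for i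
  have p: "p permutes {0..<k}"
    by (rule bij_imp_permutes, rule bij_betw_byWitness[where f' = p]) (auto simp: p_def)
  have "det (flip_rows M) = signof p * det M" if M: "M \<in> carrier_mat k k" for M :: "'a mat"
  proof -
    have "flip_rows M = mat k k (\<lambda>(i, j). M $$ (p i, j))"
      using M by (auto simp: flip_rows_def p_def intro!: cong_mat)
    then show ?thesis using det_permute_rows[OF M p] by simp
  qed
  moreover have "signof p \<in> {1, -1 :: 'a}" by (rule signof_pm_one)
  ultimately show ?thesis by (intro bexI[of _ "signof p"] ballI)
qed

text \<open>A minor of the flipped matrix is a flipped minor of \<open>A\<close> on the reflected
  rows. The factor is chosen before \<open>A\<close>, so it depends on \<open>k\<close>
  alone.\<close>

lemma minors_have_sign_flip_rows:
  "\<exists>c \<in> {1, -1}. \<forall>A s. minors_have_sign A k s \<longrightarrow> minors_have_sign (flip_rows A) k (c * s)"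
proof -
  obtain c :: real where c: "c \<in> {1, -1}" "\<And>M. M \<in> carrier_mat k k \<Longrightarrow> det (flip_rows M) = c * det M"
    using det_flip_rows[of k] by blast
  have "minors_have_sign (flip_rows A) k (c * s)" if s: "minors_have_sign A k s" for A s
  proof -
    define m n where "m = dim_row A" and "n = dim_col A"
    then have A: "A \<in> carrier_mat m n" by auto
    show ?thesis
      unfolding minors_have_sign_iff[OF flip_rows_carrier[OF A]]
    proof (intro allI impI)
      fix f g assume f: "index_seq k m f" and g: "index_seq k n g"
      \<comment> \<open>Reflecting the row indices reverses their order; running through them
        backwards makes \<open>f'\<close> increasing again.\<close>
      define f' where "f' i = m - 1 - f (k - 1 - i)" for i
      have f': "index_seq k m f'"
      proof (rule index_seqI)
        fix i j assume "i < j" "j < k"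
        then have "f (k - 1 - j) < f (k - 1 - i)" "f (k - 1 - i) < m"
          by (intro index_seq_mono[OF f] index_seq_less[OF f]; simp)+
        then show "f' i < f' j" by (auto simp: f'_def)
      next
        fix i assume "i < k"
        then show "f' i < m" using index_seq_less[OF f, of "k - 1 - i"] by (auto simp: f'_def)
      qed
      have "mat k k (\<lambda>(i, j). flip_rows A $$ (f i, g j)) =
          flip_rows (mat k k (\<lambda>(i, j). A $$ (f' i, g j)))"
        using A index_seq_less[OF f] index_seq_less[OF g]
        by (intro eq_matI) (auto simp: flip_rows_def f'_def)
      moreover have "sgn (det (mat k k (\<lambda>(i, j). A $$ (f' i, g j)))) = s"
        using s f' g by (simp add: minors_have_sign_iff[OF A])
      ultimately show "sgn (det (mat k k (\<lambda>(i, j). flip_rows A $$ (f i, g j)))) = c * s"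
        using c by (auto simp: sgn_mult)
    qed
  qed
  then show ?thesis using c(1) by blast
qed

lemma strictly_sign_regular_flip_rows:
  assumes "strictly_sign_regular A"
  shows "strictly_sign_regular (flip_rows A)"
proof -
  obtain \<epsilon> where \<epsilon>: "\<And>k. \<epsilon> k \<in> {1, -1}" "\<And>k. k \<ge> 1 \<Longrightarrow> minors_have_sign A k (\<epsilon> k)"
    using assms unfolding strictly_sign_regular_iff by blast
  obtain c where c: "\<And>k. c k \<in> {1, -1 :: real}"
    "\<And>k A s. minors_have_sign A k s \<Longrightarrow> minors_have_sign (flip_rows A) k (c k * s)"
    using minors_have_sign_flip_rows by metis
  have "c k * \<epsilon> k \<in> {1, -1}" for k using c(1)[of k] \<epsilon>(1)[of k] by auto
  then show ?thesis
    unfolding strictly_sign_regular_iff using c(2) \<epsilon>(2) by (intro exI[of _ "\<lambda>k. c k * \<epsilon> k"]) auto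
qed

lemma flip_rows_add_row_bottom: "flip_rows (add_row_bottom v (flip_rows A)) = add_row_top v A"
proof (rule eq_matI)
  fix i j assume "i < dim_row (add_row_top v A)" "j < dim_col (add_row_top v A)"
  then have i: "i < Suc (dim_row A)" and j: "j < dim_col A" by (auto simp: add_row_top_def)
  have A: "A \<in> carrier_mat (dim_row A) (dim_col A)" by simp
  have "flip_rows (add_row_bottom v (flip_rows A)) $$ (i, j) =
      add_row_bottom v (flip_rows A) $$ (dim_row A - i, j)"
    using i j by (simp add: flip_rows_def add_row_bottom_def)
  also have "\<dots> = add_row_top v A $$ (i, j)"
  proof (cases i)
    case 0
    then show ?thesis
      using add_row_index(4)[OF flip_rows_carrier[OF A] j] add_row_index(1)[OF A j] by simp
  next
    case (Suc i')
    then have "dim_row A - i < dim_row A" "dim_row A - 1 - (dim_row A - i) = i'" using i by auto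
    then show ?thesis
      using add_row_index(3)[OF flip_rows_carrier[OF A] j] add_row_index(2)[OF A j] Suc i j
      by (simp add: flip_rows_def)
  qed
  finally show "flip_rows (add_row_bottom v (flip_rows A)) $$ (i, j) = add_row_top v A $$ (i, j)" .
qed (auto simp: add_row_bottom_def add_row_top_def flip_rows_def)

lemma extends_SSR_row_top:
  assumes "extends_SSR add_row_bottom d l (flip_rows A)"
  shows "extends_SSR add_row_top d l A"
  unfolding extends_SSR_def
proof
  fix \<eta> :: real assume \<eta>: "\<eta> \<in> {1, -1}"
  obtain c :: real where c: "c \<in> {1, -1}"
    "\<And>A s. minors_have_sign A (Suc l) s \<Longrightarrow> minors_have_sign (flip_rows A) (Suc l) (c * s)"
    using minors_have_sign_flip_rows by blast
  \<comment> \<open>Flipping back multiplies the sign by \<open>c\<close>, so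
    \<open>c * \<eta>\<close> is prescribed for the flipped matrix.\<close>
  have "c * \<eta> \<in> {1, -1}" using c(1) \<eta> by auto
  then obtain v where v: "v \<in> carrier_vec d"
    "strictly_sign_regular (add_row_bottom v (flip_rows A))"
    "minors_have_sign (add_row_bottom v (flip_rows A)) (Suc l) (c * \<eta>)"
    using assms unfolding extends_SSR_def by blast
  have "c * (c * \<eta>) = \<eta>" using c(1) by auto
  then have "minors_have_sign (add_row_top v A) (Suc l) \<eta>"
    using c(2)[OF v(3)] by (simp only: flip_rows_add_row_bottom)
  then show "\<exists>v\<in>carrier_vec d. strictly_sign_regular (add_row_top v A) \<and>
      minors_have_sign (add_row_top v A) (Suc l) \<eta>"
    using v(1) strictly_sign_regular_flip_rows[OF v(2)]
    by (auto simp: flip_rows_add_row_bottom)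
qed

section \<open>The four borders\<close>

lemma extends_SSR_row_bottom:
  assumes "A \<in> carrier_mat m n" "m \<ge> 1" "strictly_sign_regular A"
  shows "extends_SSR add_row_bottom n m A"
proof (rule extends_SSR_transpose[where border = add_col_right])
  show "extends_SSR add_col_right n m A\<^sup>T"
    using assms by (intro extends_SSR_col_right) (auto simp: strictly_sign_regular_transpose)
qed (rule transpose_add_col_right)

lemma extends_SSR_all_borders:
  assumes A: "A \<in> carrier_mat m n" "m \<ge> 1" "n \<ge> 1" "strictly_sign_regular A"
  shows "\<forall>border \<in> {add_col_left, add_col_right}. extends_SSR border m n A"
    and "\<forall>border \<in> {add_row_top, add_row_bottom}. extends_SSR border n m A"
proof -
  \<comment> \<open>Stated for arbitrary matrices because the left column needs it for the
    transpose, with \<open>m\<close> and \<open>n\<close> exchanged.\<close>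
  have top: "extends_SSR add_row_top n m A"
    if "A \<in> carrier_mat m n" "m \<ge> 1" "strictly_sign_regular A" for A m n
    using that by (intro extends_SSR_row_top extends_SSR_row_bottom flip_rows_carrier
        strictly_sign_regular_flip_rows)
  have "extends_SSR add_col_left m n A"
  proof (rule extends_SSR_transpose[where border = add_row_top])
    show "extends_SSR add_row_top m n A\<^sup>T"
      using A by (intro top) (auto simp: strictly_sign_regular_transpose)
  qed (rule transpose_add_row_top)
  then show "\<forall>border \<in> {add_col_left, add_col_right}. extends_SSR border m n A"
    using extends_SSR_col_right A by blast
  show "\<forall>border \<in> {add_row_top, add_row_bottom}. extends_SSR border n m A"
    using top extends_SSR_row_bottom A by blast
qed

theorem theoremA:
  fixes A :: "real mat" and m n :: nat
  assumes "m \<ge> 1" and "n \<ge> 1"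
    and "A \<in> carrier_mat m n"
    and "strictly_sign_regular A"
  shows
    "(\<forall>add \<in> {add_col_left, add_col_right}.
        (\<exists>v \<in> carrier_vec m. strictly_sign_regular (add v A)) \<and>
        (min m (n + 1) > min m n \<longrightarrow>
          (\<forall>\<eta> \<in> {1, -1}. \<exists>v \<in> carrier_vec m.
             strictly_sign_regular (add v A) \<and>
             minors_have_sign (add v A) (min m n + 1) \<eta>))) \<and>
     (\<forall>add \<in> {add_row_top, add_row_bottom}.
        (\<exists>v \<in> carrier_vec n. strictly_sign_regular (add v A)) \<and>
        (min (m + 1) n > min m n \<longrightarrow>
          (\<forall>\<eta> \<in> {1, -1}. \<exists>v \<in> carrier_vec n.
             strictly_sign_regular (add v A) \<and>
             minors_have_sign (add v A) (min m n + 1) \<eta>)))"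
proof -
  have ex: "\<exists>v \<in> carrier_vec d. strictly_sign_regular (border v A)"
    if "extends_SSR border d l A" for border d l
    using that unfolding extends_SSR_def by blast
  \<comment> \<open>When larger minors appear, \<open>min m n\<close> equals \<open>n\<close> for a
    new column and \<open>m\<close> for a new row, which is the \<open>l\<close> of the extension
    property.\<close>
  have sized: "\<forall>\<eta> \<in> {1, -1}. \<exists>v \<in> carrier_vec d. strictly_sign_regular (border v A) \<and>
      minors_have_sign (border v A) (min m n + 1) \<eta>"
    if "extends_SSR border d l A" "min m n = l" for border d l
    using that unfolding extends_SSR_def by simp
  show ?thesis
  proof (rule conjI; rule ballI; rule conjI)
    fix border :: "real vec \<Rightarrow> real mat \<Rightarrow> real mat"
    assume "border \<in> {add_col_left, add_col_right}"
    then have *: "extends_SSR border m n A"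
      using extends_SSR_all_borders(1)[OF assms(3,1,2,4)] by blast
    show "\<exists>v \<in> carrier_vec m. strictly_sign_regular (border v A)" using ex[OF *] .
    show "min m (n + 1) > min m n \<longrightarrow> (\<forall>\<eta> \<in> {1, -1}. \<exists>v \<in> carrier_vec m. strictly_sign_regular (border v A) \<and>
        minors_have_sign (border v A) (min m n + 1) \<eta>)"
      by (intro impI sized[OF *]) auto
  next
    fix border :: "real vec \<Rightarrow> real mat \<Rightarrow> real mat"
    assume "border \<in> {add_row_top, add_row_bottom}"
    then have *: "extends_SSR border n m A"
      using extends_SSR_all_borders(2)[OF assms(3,1,2,4)] by blast
    show "\<exists>v \<in> carrier_vec n. strictly_sign_regular (border v A)" using ex[OF *] .
    show "min (m + 1) n > min m n \<longrightarrow> (\<forall>\<eta> \<in> {1, -1}. \<exists>v \<in> carrier_vec n. strictly_sign_regular (border v A) \<and>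
        minors_have_sign (border v A) (min m n + 1) \<eta>)"
      by (intro impI sized[OF *]) auto
  qed
qed

end
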